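(* Let $D\subseteq\mathbb{R}^d$ be open, let $f:D\to\mathbb{R}^d$ be locally Lipschitz, let $x^*\in D$ be an equilibrium of $\dot x=f(x)$, and let $S\subseteq D$ be a compact set with $x^*\in\mathrm{int}(S)$. Let $V:D\to\mathbb{R}_{\ge0}$ be an Exponential Recurrent Lyapunov Function (ERLF) over $S$ with constants $a_1,a_2,\alpha,\tau>0$. Then $x^*$ is exponentially stable with rate $\alpha$ on the set $S$; that is, for every $x\in S$, $$\|\phi(t,x)-x^*\|\le C\,e^{-\alpha t}\,\|x-x^*\|,\qquad t\ge 0,$$ with $$C:=\frac{a_2}{a_1}\,e^{\alpha\tau}\bigl(1+\overline L\,h(\tau;L)\bigr),$$ where $L:=L_{\mathrm{cl}\,\mathcal{R}^\tau(S)}$ is the one-sided Lipschitz constant of $f$ over $\mathrm{cl}\,\mathcal{R}^\tau(S)$, $\overline L:=\overline L_{\mathrm{cl}\,\mathcal{R}^\tau(S)}$ is a Lipschitz constant of $f$ over $\mathrm{cl}\,\mathcal{R}^\tau(S)$, and $h(\tau;L)=(e^{L\tau}-1)/L$ if $L\ne0$, $h(\tau;0)=\tau$.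
   Context: $\|\cdot\|$ is a fixed norm on $\mathbb{R}^d$. Locally Lipschitz means: for every compact $K\subset D$ there is $\overline L_K\ge 0$ (a Lipschitz constant over $K$) with $\|f(y)-f(x)\|\le \overline L_K\|y-x\|$ for all $x,y\in K$. For $x\in D$, $\phi(t,x)$ is the solution of $\dot x=f(x)$ with $\phi(0,x)=x$, defined on its maximal open interval of existence $I(x)\ni 0$. An assertion about $\phi(t,x)$ for all $t\ge0$ includes that the solution exists for all $t\ge 0$. Weak pairing: the norm is equipped with an associated weak pairing $[\cdot;\cdot]:\mathbb{R}^d\times\mathbb{R}^d\to\mathbb{R}$, i.e. a map with (i) $[x_1+x_2;y]\le[x_1;y]+[x_2;y]$; (ii) $[\alpha x;y]=[x;\alpha y]=\alpha[x;y]$ for $\alpha>0$ and $[-x;-y]=[x;y]$; (iii) $[x;x]>0$ for $x\ne0$; (iv) $|[x;y]|\le[x;x]^{1/2}[y;y]^{1/2}$; such that $\|x\|=[x;x]^{1/2}$, and satisfying the curve norm derivative formula $\|x(t)\|\,D^+\|x(t)\|=[\dot x(t);x(t)]$ along differentiable curves, where $D^+\varphi(t)=\limsup_{h\to0^+}(\varphi(t+h)-\varphi(t))/h$. The one-sided Lipschitz constant of $f$ over a compact $K\subset D$ is the smallest $L_K\in\mathbb{R}$ with $[f(y)-f(x);y-x]\le L_K\|y-x\|^2$ for all $x,y\in K$. Reachable tube: $\mathcal{R}^\tau(S)=\{\phi(t,x): x\in S,\ t\in[0,\tau]\cap I(x)\}$. Containment times: $T_S(x;\tau):=\{t\in(0,\tau]: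 \phi(t,x)\in S\}$ (with $t\in I(x)$). An inequality $\min_{s\in T_S(x;\tau)}g(s)\le c$ means that there is $s\in T_S(x;\tau)$ with $g(s)\le c$; in particular $T_S(x;\tau)\neq\emptyset$. ERLF: a continuous $V:D\to\mathbb{R}_{\ge0}$ is an Exponential Recurrent Lyapunov Function over $S$ if there are constants $a_1,a_2,\alpha,\tau>0$ with (i) $a_1\|x-x^*\|\le V(x)\le a_2\|x-x^*\|$ for all $x\in D$; (ii) $\min_{s\in T_S(x;\tau)}e^{\alpha s}V(\phi(s,x))\le V(x)$ for all $x\in S\setminus\{x^*\}$. *)

theory Defs
  imports "HOL-Analysis.Analysis"
begin

text \<open>
  The norm on \<open>\<real>\<^sup>d\<close> is arbitrary, so it is an explicit function \<open>N\<close> on \<open>real ^ 'n\<close>.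
  Topological notions and derivatives are those of the type; all norms on \<open>\<real>\<^sup>d\<close> induce the same ones.
\<close>

definition is_norm :: "(real ^ 'n \<Rightarrow> real) \<Rightarrow> bool" where
  "is_norm N \<longleftrightarrow>
     (\<forall>x. 0 \<le> N x) \<and>
     (\<forall>x. N x = 0 \<longleftrightarrow> x = 0) \<and>
     (\<forall>c x. N (c *\<^sub>R x) = \<bar>c\<bar> * N x) \<and>
     (\<forall>x y. N (x + y) \<le> N x + N y)"

definition upper_right_dini :: "(real \<Rightarrow> real) \<Rightarrow> real \<Rightarrow> ereal" where
  "upper_right_dini g t = Limsup (at_right 0) (\<lambda>h. ereal ((g (t + h) - g t) / h))"

definition weak_pairing :: "(real ^ 'n \<Rightarrow> real ^ 'n \<Rightarrow> real) \<Rightarrow> bool" where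
  "weak_pairing wp \<longleftrightarrow>
     (\<forall>x1 x2 y. wp (x1 + x2) y \<le> wp x1 y + wp x2 y) \<and>
     (\<forall>a x y. 0 < a \<longrightarrow> wp (a *\<^sub>R x) y = a * wp x y \<and> wp x (a *\<^sub>R y) = a * wp x y) \<and>
     (\<forall>x y. wp (- x) (- y) = wp x y) \<and>
     (\<forall>x. x \<noteq> 0 \<longrightarrow> 0 < wp x x) \<and>
     (\<forall>x y. \<bar>wp x y\<bar> \<le> sqrt (wp x x) * sqrt (wp y y))"

definition curve_norm_derivative_formula ::
    "(real ^ 'n \<Rightarrow> real) \<Rightarrow> (real ^ 'n \<Rightarrow> real ^ 'n \<Rightarrow> real) \<Rightarrow> bool" where
  "curve_norm_derivative_formula N wp \<longleftrightarrow>
     (\<forall>x x' a b. (\<forall>t\<in>{a<..<b}. (x has_vector_derivative x' t) (at t)) \<longrightarrow>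
        (\<forall>t\<in>{a<..<b}. ereal (N (x t)) * upper_right_dini (\<lambda>s. N (x s)) t = ereal (wp (x' t) (x t))))"

definition associated_weak_pairing ::
    "(real ^ 'n \<Rightarrow> real) \<Rightarrow> (real ^ 'n \<Rightarrow> real ^ 'n \<Rightarrow> real) \<Rightarrow> bool" where
  "associated_weak_pairing N wp \<longleftrightarrow>
     weak_pairing wp \<and> (\<forall>x. N x = sqrt (wp x x)) \<and> curve_norm_derivative_formula N wp"

definition lipschitz_const_over ::
    "(real ^ 'n \<Rightarrow> real) \<Rightarrow> (real ^ 'n \<Rightarrow> real ^ 'n) \<Rightarrow> (real ^ 'n) set \<Rightarrow> real \<Rightarrow> bool" where
  "lipschitz_const_over N f K M \<longleftrightarrow> 0 \<le> M \<and> (\<forall>x\<in>K. \<forall>y\<in>K. N (f y - f x) \<le> M * N (y - x))"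

definition locally_lipschitz ::
    "(real ^ 'n \<Rightarrow> real) \<Rightarrow> (real ^ 'n) set \<Rightarrow> (real ^ 'n \<Rightarrow> real ^ 'n) \<Rightarrow> bool" where
  "locally_lipschitz N D f \<longleftrightarrow> (\<forall>K. compact K \<and> K \<subseteq> D \<longrightarrow> (\<exists>M. lipschitz_const_over N f K M))"

definition one_sided_lipschitz_const ::
    "(real ^ 'n \<Rightarrow> real) \<Rightarrow> (real ^ 'n \<Rightarrow> real ^ 'n \<Rightarrow> real) \<Rightarrow>
     (real ^ 'n \<Rightarrow> real ^ 'n) \<Rightarrow> (real ^ 'n) set \<Rightarrow> real" where
  "one_sided_lipschitz_const N wp f K =
     (LEAST L. \<forall>x\<in>K. \<forall>y\<in>K. wp (f y - f x) (y - x) \<le> L * (N (y - x))\<^sup>2)"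

definition solves_ivp ::
    "(real ^ 'n \<Rightarrow> real ^ 'n) \<Rightarrow> (real ^ 'n) set \<Rightarrow> real ^ 'n \<Rightarrow> real set \<Rightarrow> (real \<Rightarrow> real ^ 'n) \<Rightarrow> bool" where
  "solves_ivp f D x J u \<longleftrightarrow>
     open J \<and> is_interval J \<and> 0 \<in> J \<and> u 0 = x \<and>
     (\<forall>t\<in>J. u t \<in> D \<and> (u has_vector_derivative f (u t)) (at t))"

text \<open>
  For locally Lipschitz \<open>f\<close> any two solutions agree on the intersection of their intervals, so the
  maximal interval of existence is the union of all solution intervals, and the value in \<open>flow\<close> is
  unique at every time in it.
\<close>

definition existence_ivl ::
    "(real ^ 'n \<Rightarrow> real ^ 'n) \<Rightarrow> (real ^ 'n) set \<Rightarrow> real ^ 'n \<Rightarrow> real set" where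
  "existence_ivl f D x = \<Union> {J. \<exists>u. solves_ivp f D x J u}"

definition flow ::
    "(real ^ 'n \<Rightarrow> real ^ 'n) \<Rightarrow> (real ^ 'n) set \<Rightarrow> real \<Rightarrow> real ^ 'n \<Rightarrow> real ^ 'n" where
  "flow f D t x = (THE y. \<exists>J u. solves_ivp f D x J u \<and> t \<in> J \<and> y = u t)"

definition reachable_tube ::
    "(real ^ 'n \<Rightarrow> real ^ 'n) \<Rightarrow> (real ^ 'n) set \<Rightarrow> real \<Rightarrow> (real ^ 'n) set \<Rightarrow> (real ^ 'n) set" where
  "reachable_tube f D \<tau> S = {flow f D t x | t x. x \<in> S \<and> t \<in> {0..\<tau>} \<inter> existence_ivl f D x}"

definition containment_times ::
    "(real ^ 'n \<Rightarrow> real ^ 'n) \<Rightarrow> (real ^ 'n) set \<Rightarrow> (real ^ 'n) set \<Rightarrow> real ^ 'n \<Rightarrow> real \<Rightarrow> real set" where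
  "containment_times f D S x \<tau> = {t \<in> {0<..\<tau>} \<inter> existence_ivl f D x. flow f D t x \<in> S}"

definition ERLF ::
    "(real ^ 'n \<Rightarrow> real) \<Rightarrow> (real ^ 'n \<Rightarrow> real ^ 'n) \<Rightarrow> (real ^ 'n) set \<Rightarrow> real ^ 'n \<Rightarrow>
     (real ^ 'n) set \<Rightarrow> (real ^ 'n \<Rightarrow> real) \<Rightarrow> real \<Rightarrow> real \<Rightarrow> real \<Rightarrow> real \<Rightarrow> bool" where
  "ERLF N f D xs S V a1 a2 \<alpha> \<tau> \<longleftrightarrow>
     continuous_on D V \<and> (\<forall>x\<in>D. 0 \<le> V x) \<and>
     0 < a1 \<and> 0 < a2 \<and> 0 < \<alpha> \<and> 0 < \<tau> \<and>
     (\<forall>x\<in>D. a1 * N (x - xs) \<le> V x \<and> V x \<le> a2 * N (x - xs)) \<and>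
     (\<forall>x\<in>S - {xs}. \<exists>s\<in>containment_times f D S x \<tau>. exp (\<alpha> * s) * V (flow f D s x) \<le> V x)"

definition h_fun :: "real \<Rightarrow> real \<Rightarrow> real" where
  "h_fun \<tau> L = (if L = 0 then \<tau> else (exp (L * \<tau>) - 1) / L)"

end

theory Submission
  imports Defs
begin

text \<open>
  Fix \<open>x \<in> S\<close> and call \<open>m \<ge> 0\<close> good if \<open>\<phi>(m,x) \<in> S\<close> and \<open>e\<^bsup>\<alpha>m\<^esup> V(\<phi>(m,x)) \<le> V(x)\<close>. By the recurrence
  condition every good time is followed by another one at distance at most \<open>\<tau>\<close>, but the steps may
  shrink. Since solutions starting in the compact set \<open>S\<close> exist for a uniform time \<open>\<delta>\<close>, a limit of
  good times lies in the interval of existence and is again good; hence good times cannot accumulate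
  at a finite supremum, solutions exist for all \<open>t \<ge> 0\<close>, and every \<open>t\<close> has a good time in
  \<open>[t - \<tau>, t]\<close>. Continuous dependence on initial values makes the reachable tube compact. Between
  good times, the curve norm derivative formula gives
  \<open>\<parallel>\<phi>(r,y) - x\<^sup>*\<parallel> \<le> e\<^bsup>Lr\<^esup> \<parallel>y - x\<^sup>*\<parallel>\<close>, and \<open>e\<^bsup>Lr\<^esup> = 1 + L h(r;L) \<le> 1 + Lbar h(\<tau>;L)\<close> because \<open>L \<le> Lbar\<close>
  by the Cauchy-Schwarz property of the weak pairing.
\<close>

subsection \<open>Gronwall and Picard-Lindeloef estimates\<close>

text \<open>Working with the squared distance avoids differentiating the norm where the curves meet:
  its derivative is at most \<open>2 * M\<close> times itself by Cauchy-Schwarz. The Lipschitz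
  estimate is asked only along the two curves, so a constant for a compact set containing both arcs
  suffices.\<close>

lemma norm_diff_solutions_le_exp:
  fixes u v :: "real \<Rightarrow> 'a::real_inner"
  assumes T: "0 \<le> T"
    and u: "\<And>s. s \<in> {0..T} \<Longrightarrow> (u has_vector_derivative g (u s)) (at s)"
    and v: "\<And>s. s \<in> {0..T} \<Longrightarrow> (v has_vector_derivative g (v s)) (at s)"
    and lip: "\<And>s. s \<in> {0..T} \<Longrightarrow> norm (g (u s) - g (v s)) \<le> M * norm (u s - v s)"
  shows "norm (u T - v T) \<le> exp (M * T) * norm (u 0 - v 0)"
proof -
  define q where "q s = (u s - v s) \<bullet> (u s - v s)" for s
  have qd: "(q has_real_derivative 2 * ((u s - v s) \<bullet> (g (u s) - g (v s)))) (at s)"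
    if "s \<in> {0..T}" for s
  proof -
    have d: "((\<lambda>s. u s - v s) has_vector_derivative g (u s) - g (v s)) (at s)"
      using u[OF that] v[OF that] by (rule has_vector_derivative_diff)
    show ?thesis
      using bounded_bilinear.has_vector_derivative[OF bounded_bilinear_inner d d]
      unfolding q_def has_real_derivative_iff_has_vector_derivative
      by (simp add: inner_commute)
  qed
  have "exp (- 2 * M * T) * q T \<le> exp (- 2 * M * 0) * q 0"
  proof (rule DERIV_nonpos_imp_nonincreasing[OF T])
    fix s assume s: "0 \<le> s" "s \<le> T"
    let ?d = "2 * ((u s - v s) \<bullet> (g (u s) - g (v s)))"
    have "(u s - v s) \<bullet> (g (u s) - g (v s)) \<le> norm (u s - v s) * norm (g (u s) - g (v s))"
      by (rule norm_cauchy_schwarz)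
    also have "\<dots> \<le> norm (u s - v s) * (M * norm (u s - v s))"
      using lip s by (intro mult_left_mono) auto
    also have "\<dots> = M * q s"
      by (simp add: q_def dot_square_norm power2_eq_square)
    finally have le: "?d - 2 * M * q s \<le> 0" by simp
    have "((\<lambda>s. exp (- 2 * M * s) * q s) has_real_derivative
        exp (- 2 * M * s) * (?d - 2 * M * q s)) (at s)"
      by (rule derivative_eq_intros qd refl | use s in \<open>simp add: algebra_simps\<close>)+
    with le show "\<exists>y. ((\<lambda>s. exp (- 2 * M * s) * q s) has_real_derivative y) (at s) \<and> y \<le> 0"
      by (meson exp_ge_zero mult_nonneg_nonpos)
  qed
  then have "q T \<le> exp (2 * M * T) * q 0"
    by (simp add: exp_minus field_simps)
  then have "(norm (u T - v T))\<^sup>2 \<le> (exp (M * T) * norm (u 0 - v 0))\<^sup>2"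
    by (simp add: q_def dot_square_norm power_mult_distrib exp_double[symmetric] mult.assoc)
  then show ?thesis
    by (rule power2_le_imp_le) simp
qed

lemma picard_local_solution:
  fixes g :: "'a::euclidean_space \<Rightarrow> 'a"
  assumes r: "0 < r" and \<delta>: "0 < \<delta>" and M: "0 \<le> M" "3 * \<delta> * M < 1" and B: "3 * \<delta> * B \<le> r"
    and lip: "\<And>y z. y \<in> cball x r \<Longrightarrow> z \<in> cball x r \<Longrightarrow> norm (g y - g z) \<le> M * norm (y - z)"
    and bound: "\<And>y. y \<in> cball x r \<Longrightarrow> norm (g y) \<le> B"
  shows "\<exists>u. u 0 = x \<and>
    (\<forall>t\<in>{- \<delta><..<\<delta>}. u t \<in> cball x r \<and> (u has_vector_derivative g (u t)) (at t))"
proof -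
  \<comment> \<open>Projecting onto the ball makes the field globally Lipschitz and bounded, so the fixed point can
    be sought in the whole Banach space of bounded continuous functions.\<close>
  define G where "G y = g (closest_point (cball x r) y)" for y
  have cp: "closest_point (cball x r) y \<in> cball x r" for y
    using r by (intro closest_point_in_set) auto
  have G_lip: "norm (G y - G z) \<le> M * norm (y - z)" for y z
  proof -
    have "norm (G y - G z) \<le> M * dist (closest_point (cball x r) y) (closest_point (cball x r) z)"
      unfolding G_def dist_norm using lip cp by blast
    also have "\<dots> \<le> M * dist y z"
      using M r by (intro mult_left_mono closest_point_lipschitz) auto
    finally show ?thesis by (simp add: dist_norm)
  qed
  have G_bound: "norm (G y) \<le> B" for y
    unfolding G_def using bound cp by blast
  have G_cont: "continuous_on UNIV G"
    using G_lip M by (intro lipschitz_on_continuous_on[of M] lipschitz_onI) (auto simp: dist_norm)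
  \<comment> \<open>Clamping time to the interval turns the integral into a bounded function on the
    whole real line, as the function space requires.\<close>
  define cl where "cl t = max (- \<delta>) (min \<delta> t)" for t
  have cl: "cl t \<in> {- \<delta>..\<delta>}" for t using \<delta> by (auto simp: cl_def)
  \<comment> \<open>The integral from 0 to \<open>t\<close>, for either sign of \<open>t\<close>, is
    a difference of integrals starting at \<open>- \<delta>\<close>. Bounding the two separately,
    over lengths at most \<open>2 * \<delta>\<close> and \<open>\<delta>\<close>, gives the factor 3
    in the hypotheses.\<close>
  define I where "I w t = integral {- \<delta>..cl t} w - integral {- \<delta>..0} w" for w :: "real \<Rightarrow> 'a" and t
  have I_bound: "norm (I w t) \<le> 3 * \<delta> * b"
    if w: "continuous_on UNIV w" and b: "\<And>s. norm (w s) \<le> b" for w t b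
  proof -
    have "0 \<le> b" using b[of 0] norm_ge_zero order_trans by blast
    have "norm (I w t) \<le> norm (integral {- \<delta>..cl t} w) + norm (integral {- \<delta>..0} w)"
      unfolding I_def by (rule norm_triangle_ineq4)
    also have "\<dots> \<le> b * (cl t - (- \<delta>)) + b * (0 - (- \<delta>))"
      using cl[of t] \<delta> b by (intro add_mono integral_bound continuous_on_subset[OF w]) auto
    also have "\<dots> \<le> b * (2 * \<delta>) + b * \<delta>"
      using cl[of t] \<open>0 \<le> b\<close> by (intro add_mono mult_left_mono) auto
    finally show ?thesis by (simp add: algebra_simps)
  qed
  have I_diff: "I (\<lambda>s. w s - z s) t = I w t - I z t"
    if "continuous_on UNIV w" "continuous_on UNIV z" for w z t
  proof -
    have "w integrable_on {a..b}" "z integrable_on {a..b}" for a b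
      using that by (auto intro!: integrable_continuous_interval intro: continuous_on_subset)
    then show ?thesis by (simp add: I_def Henstock_Kurzweil_Integration.integral_diff)
  qed
  have I_cont: "continuous_on UNIV (I w)" if w: "continuous_on UNIV w" for w
  proof -
    have "continuous_on {- \<delta>..\<delta>} (\<lambda>t. integral {- \<delta>..t} w)"
      by (intro indefinite_integral_continuous_1 integrable_continuous_interval continuous_on_subset[OF w]) auto
    then have "continuous_on UNIV (\<lambda>t. integral {- \<delta>..cl t} w)"
      by (rule continuous_on_compose2) (use cl in \<open>auto simp: cl_def intro!: continuous_intros\<close>)
    then show ?thesis unfolding I_def by (intro continuous_intros)
  qed
  have Gw: "continuous_on UNIV (\<lambda>s. G (apply_bcontfun w s))" for w
    by (rule continuous_on_compose2[OF G_cont]) (auto intro: continuous_on_apply_bcontfun)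
  define P where "P w t = x + I (\<lambda>s. G (apply_bcontfun w s)) t" for w :: "real \<Rightarrow>\<^sub>C 'a" and t
  have P_bcont: "P w \<in> bcontfun" for w
    unfolding P_def
  proof (intro bcontfun_normI)
    show "continuous_on UNIV (\<lambda>t. x + I (\<lambda>s. G (apply_bcontfun w s)) t)"
      by (intro continuous_intros I_cont Gw)
    show "norm (x + I (\<lambda>s. G (apply_bcontfun w s)) t) \<le> norm x + 3 * \<delta> * B" for t
      using I_bound[OF Gw[of w], of B t] G_bound norm_triangle_ineq[of x "I (\<lambda>s. G (apply_bcontfun w s)) t"]
      by (smt (verit))
  qed
  have "\<exists>!w. Bcontfun (P w) = w"
  proof (rule banach_fix_type)
    show "0 \<le> 3 * \<delta> * M" "3 * \<delta> * M < 1" using M \<delta> by auto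
    show "\<forall>w z. dist (Bcontfun (P w)) (Bcontfun (P z)) \<le> 3 * \<delta> * M * dist w z"
    proof (intro allI dist_bound)
      fix w z :: "real \<Rightarrow>\<^sub>C 'a" and t
      have "norm (P w t - P z t) = norm (I (\<lambda>s. G (apply_bcontfun w s) - G (apply_bcontfun z s)) t)"
        by (simp add: P_def I_diff Gw)
      also have "\<dots> \<le> 3 * \<delta> * (M * dist w z)"
      proof (rule I_bound)
        show "continuous_on UNIV (\<lambda>s. G (apply_bcontfun w s) - G (apply_bcontfun z s))"
          by (intro continuous_intros Gw)
        fix s
        have "norm (G (apply_bcontfun w s) - G (apply_bcontfun z s)) \<le> M * dist (apply_bcontfun w s) (apply_bcontfun z s)"
          using G_lip by (simp add: dist_norm)
        also have "\<dots> \<le> M * dist w z" using M by (intro mult_left_mono dist_bounded) auto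
        finally show "norm (G (apply_bcontfun w s) - G (apply_bcontfun z s)) \<le> M * dist w z" .
      qed
      finally show "dist (apply_bcontfun (Bcontfun (P w)) t) (apply_bcontfun (Bcontfun (P z)) t) \<le> 3 * \<delta> * M * dist w z"
        by (simp add: Bcontfun_inverse P_bcont dist_norm mult.assoc)
    qed
  qed
  then obtain w where "Bcontfun (P w) = w" by blast
  then have "apply_bcontfun w = P w" by (metis Bcontfun_inverse P_bcont)
  then have w: "apply_bcontfun w t = x + I (\<lambda>s. G (apply_bcontfun w s)) t" for t
    using P_def by metis
  let ?u = "apply_bcontfun w"
  \<comment> \<open>The bound on the field keeps the fixed point inside the ball, where the
    projection is the identity; hence the modified field may be replaced by
    \<open>g\<close>.\<close>
  have w_in: "?u t \<in> cball x r" for t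
    using I_bound[OF Gw[of w], of B t] G_bound B by (subst w) (simp add: dist_norm)
  have Gg: "G (?u t) = g (?u t)" for t
    unfolding G_def using closest_point_self[OF w_in] by simp
  have "(?u has_vector_derivative g (?u t)) (at t)" if t: "t \<in> {- \<delta><..<\<delta>}" for t
  proof -
    have "((\<lambda>t. integral {- \<delta>..t} (\<lambda>s. G (?u s))) has_vector_derivative G (?u t)) (at t within {- \<delta>..\<delta>})"
      using t by (intro integral_has_vector_derivative continuous_on_subset[OF Gw]) auto
    then have "((\<lambda>t. integral {- \<delta>..t} (\<lambda>s. G (?u s))) has_vector_derivative G (?u t)) (at t)"
      using t by (simp add: at_within_Icc_at)
    then have "((\<lambda>t. x + (integral {- \<delta>..t} (\<lambda>s. G (?u s)) - integral {- \<delta>..0} (\<lambda>s. G (?u s))))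
        has_vector_derivative G (?u t)) (at t)"
      by (auto intro!: derivative_eq_intros)
    then show ?thesis unfolding Gg
    proof (rule has_vector_derivative_transform_within_open[OF _ _ t])
      fix s assume "s \<in> {- \<delta><..<\<delta>}"
      then have "cl s = s" by (auto simp: cl_def)
      then show "x + (integral {- \<delta>..s} (\<lambda>s. g (?u s)) - integral {- \<delta>..0} (\<lambda>s. g (?u s))) = ?u s"
        using w[of s] by (simp add: I_def Gg)
    qed simp
  qed
  moreover have "?u 0 = x"
    using \<delta> by (subst w) (simp add: I_def cl_def)
  ultimately show ?thesis using w_in by blast
qed

subsection \<open>The flow of a locally Lipschitz vector field\<close>

text \<open>The Lipschitz condition is in the Euclidean norm, so that inner products and the space
  of bounded continuous functions can be used; the arbitrary norm comes in later through equivalence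
  of norms, in \<open>locally_lipschitz_imp_field\<close>.\<close>

locale locally_lipschitz_field =
  fixes f :: "real ^ 'n \<Rightarrow> real ^ 'n" and D :: "(real ^ 'n) set"
  assumes open_domain: "open D"
    and lipschitz_on_compact: "\<And>K. compact K \<Longrightarrow> K \<subseteq> D \<Longrightarrow>
      \<exists>M\<ge>0. \<forall>y\<in>K. \<forall>z\<in>K. norm (f y - f z) \<le> M * norm (y - z)"
begin

section \<open>Local existence, uniform over compact sets\<close>

lemma compact_neighbourhood:
  assumes "compact K" "K \<subseteq> D"
  obtains r where "0 < r" "compact (\<Union>x\<in>K. cball x r)" "(\<Union>x\<in>K. cball x r) \<subseteq> D"
proof -
  obtain r where "0 < r" "(\<Union>x\<in>K. cball x r) \<subseteq> D"
    using compact_subset_open_imp_cball_epsilon_subset[OF assms(1) open_domain assms(2)] by blast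
  then show ?thesis using that compact_minkowski_sum_cball[OF assms(1), of r] by simp
qed

text \<open>A closed neighbourhood of \<open>K\<close> inside \<open>D\<close> is compact, so one
  Lipschitz constant and one bound on \<open>f\<close> serve all initial points in \<open>K\<close>,
  and the length of the Picard interval depends only on these and on the radius.\<close>

lemma uniform_local_existence:
  assumes "compact K" "K \<subseteq> D"
  obtains \<delta> where "0 < \<delta>" "\<And>x. x \<in> K \<Longrightarrow> \<exists>u. solves_ivp f D x {- \<delta><..<\<delta>} u"
proof -
  obtain r where r: "0 < r" "compact (\<Union>x\<in>K. cball x r)" "(\<Union>x\<in>K. cball x r) \<subseteq> D"
    using compact_neighbourhood[OF assms] .
  let ?K = "\<Union>x\<in>K. cball x r"
  obtain M where M: "M \<ge> 0" "\<And>y z. y \<in> ?K \<Longrightarrow> z \<in> ?K \<Longrightarrow> norm (f y - f z) \<le> M * norm (y - z)"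
    using lipschitz_on_compact[OF r(2,3)] by blast
  have "continuous_on ?K f"
    using M by (intro lipschitz_on_continuous_on[of M] lipschitz_onI) (auto simp: dist_norm)
  then have "bounded (f ` ?K)"
    using r(2) compact_continuous_image compact_imp_bounded by blast
  then obtain B where B: "0 < B" "\<And>y. y \<in> ?K \<Longrightarrow> norm (f y) \<le> B"
    unfolding bounded_pos by blast
  \<comment> \<open>The two terms come from solving \<open>3 * \<delta> * M < 1\<close> and
    \<open>3 * \<delta> * B \<le> r\<close>; \<open>M + 1\<close> makes the first inequality strict
    and avoids a division by zero when \<open>M = 0\<close>.\<close>
  define \<delta> where "\<delta> = min (1 / (3 * (M + 1))) (r / (3 * B))"
  have \<delta>: "0 < \<delta>" using M B r by (simp add: \<delta>_def)
  have "\<delta> \<le> 1 / (3 * (M + 1))" "\<delta> \<le> r / (3 * B)" by (simp_all add: \<delta>_def)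
  then have "3 * \<delta> * (M + 1) \<le> 1" and \<delta>B: "3 * \<delta> * B \<le> r"
    using M B by (simp_all add: field_simps)
  moreover have "3 * \<delta> * M < 3 * \<delta> * (M + 1)" using \<delta> by simp
  ultimately have \<delta>M: "3 * \<delta> * M < 1" by linarith
  show ?thesis
  proof
    show "0 < \<delta>" by fact
    fix x assume x: "x \<in> K"
    then have sub: "cball x r \<subseteq> ?K" by blast
    have "\<exists>u. u 0 = x \<and> (\<forall>t\<in>{- \<delta><..<\<delta>}. u t \<in> cball x r \<and> (u has_vector_derivative f (u t)) (at t))"
      by (rule picard_local_solution[OF r(1) \<delta> M(1) \<delta>M \<delta>B])
        (auto intro!: M(2) B(2) simp del: UN_iff intro: subsetD[OF sub])
    then obtain u where u: "u 0 = x"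
      "\<And>t. t \<in> {- \<delta><..<\<delta>} \<Longrightarrow> u t \<in> cball x r \<and> (u has_vector_derivative f (u t)) (at t)"
      by blast
    have "solves_ivp f D x {- \<delta><..<\<delta>} u"
      unfolding solves_ivp_def
    proof (intro conjI ballI)
      fix t assume t: "t \<in> {- \<delta><..<\<delta>}"
      show "u t \<in> D" using u(2)[OF t] sub r(3) by blast
      show "(u has_vector_derivative f (u t)) (at t)" using u(2)[OF t] by blast
    qed (use \<delta> u(1) in \<open>auto simp: is_interval_oo\<close>)
    then show "\<exists>u. solves_ivp f D x {- \<delta><..<\<delta>} u" by blast
  qed
qed

section \<open>Uniqueness of solutions\<close>

lemma solves_ivp_segment:
  assumes "solves_ivp f D x J u" "t \<in> J" "0 \<le> t" "s \<in> {0..t}"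
  shows "s \<in> J"
proof -
  have "is_interval J" "0 \<in> J" using assms(1) by (simp_all add: solves_ivp_def)
  then show ?thesis
    using mem_is_interval_1_I[of J 0 t s] assms(2,4) by simp
qed

lemma solves_ivp_compact_image:
  assumes u: "solves_ivp f D x J u" and t: "t \<in> J" "0 \<le> t"
  shows "compact (u ` {0..t})" "u ` {0..t} \<subseteq> D"
proof -
  have J: "{0..t} \<subseteq> J" using solves_ivp_segment[OF u t] by blast
  then have "continuous_on {0..t} u"
    using u unfolding solves_ivp_def
    by (intro continuous_at_imp_continuous_on ballI)
      (meson has_vector_derivative_continuous subsetD)
  then show "compact (u ` {0..t})" by (rule compact_continuous_image) simp
  show "u ` {0..t} \<subseteq> D" using J u unfolding solves_ivp_def by blast
qed

lemma solves_ivp_unique_forward: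
  assumes u: "solves_ivp f D x J u" and v: "solves_ivp f D x J' v"
    and t: "t \<in> J" "t \<in> J'" "0 \<le> t"
  shows "u t = v t"
proof -
  let ?K = "u ` {0..t} \<union> v ` {0..t}"
  obtain M where M: "\<And>y z. y \<in> ?K \<Longrightarrow> z \<in> ?K \<Longrightarrow> norm (f y - f z) \<le> M * norm (y - z)"
    using lipschitz_on_compact[of ?K] solves_ivp_compact_image[OF u t(1,3)]
      solves_ivp_compact_image[OF v t(2,3)] by (meson compact_Un le_sup_iff)
  have "norm (u t - v t) \<le> exp (M * t) * norm (u 0 - v 0)"
  proof (rule norm_diff_solutions_le_exp[OF t(3)])
    fix s assume s: "s \<in> {0..t}"
    show "(u has_vector_derivative f (u s)) (at s)" "(v has_vector_derivative f (v s)) (at s)"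
      using u v solves_ivp_segment[OF u t(1,3) s] solves_ivp_segment[OF v t(2,3) s]
      unfolding solves_ivp_def by blast+
    show "norm (f (u s) - f (v s)) \<le> M * norm (u s - v s)"
      using s by (intro M) auto
  qed
  then show ?thesis using u v by (simp add: solves_ivp_def)
qed

lemma locally_lipschitz_field_uminus: "locally_lipschitz_field (\<lambda>y. - f y) D"
proof
  show "open D" by (rule open_domain)
  fix K assume "compact K" "K \<subseteq> D"
  then show "\<exists>M\<ge>0. \<forall>y\<in>K. \<forall>z\<in>K. norm (- f y - - f z) \<le> M * norm (y - z)"
    using lipschitz_on_compact[of K] by (simp add: norm_minus_commute)
qed

text \<open>Serves to get uniqueness at negative times from forward uniqueness for the reversed
  field, which is again locally Lipschitz.\<close>

lemma solves_ivp_reverse: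
  assumes "solves_ivp f D x J u"
  shows "solves_ivp (\<lambda>y. - f y) D x {s. - s \<in> J} (\<lambda>s. u (- s))"
  unfolding solves_ivp_def
proof (intro conjI ballI)
  have J: "open J" "is_interval J" "0 \<in> J" "u 0 = x"
    "\<And>t. t \<in> J \<Longrightarrow> u t \<in> D \<and> (u has_vector_derivative f (u t)) (at t)"
    using assms unfolding solves_ivp_def by auto
  show "open {s. - s \<in> J}"
    using open_vimage[OF J(1), of uminus] by (simp add: vimage_def continuous_on_minus)
  show "is_interval {s. - s \<in> J}"
    using J(2) unfolding is_interval_1 by (metis mem_Collect_eq neg_le_iff_le)
  show "0 \<in> {s. - s \<in> J}" "u (- 0) = x" using J by auto
  fix t assume "t \<in> {s. - s \<in> J}"
  then have t: "- t \<in> J" by simp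
  show "u (- t) \<in> D" using J(5)[OF t] by simp
  have "(uminus has_vector_derivative - 1) (at t)"
    by (auto intro!: derivative_eq_intros)
  from vector_diff_chain_at[OF this] J(5)[OF t]
  show "((\<lambda>s. u (- s)) has_vector_derivative - f (u (- t))) (at t)"
    by (fastforce simp: o_def)
qed

lemma solves_ivp_unique:
  assumes u: "solves_ivp f D x J u" and v: "solves_ivp f D x J' v"
    and t: "t \<in> J" "t \<in> J'"
  shows "u t = v t"
proof (cases "0 \<le> t")
  case True
  then show ?thesis using solves_ivp_unique_forward assms by blast
next
  case False
  interpret neg: locally_lipschitz_field "\<lambda>y. - f y" D
    by (rule locally_lipschitz_field_uminus)
  show ?thesis
    using neg.solves_ivp_unique_forward[OF solves_ivp_reverse[OF u] solves_ivp_reverse[OF v], of "- t"]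
      t False by simp
qed

section \<open>The maximal solution and the group law of the flow\<close>

lemma solves_ivp_imp_flow:
  assumes u: "solves_ivp f D x J u" and t: "t \<in> J"
  shows "t \<in> existence_ivl f D x" "flow f D t x = u t"
proof -
  show "t \<in> existence_ivl f D x" unfolding existence_ivl_def using assms by blast
  show "flow f D t x = u t"
    unfolding flow_def by (rule the_equality) (use assms solves_ivp_unique in blast)+
qed

lemma existence_ivlE:
  assumes "t \<in> existence_ivl f D x"
  obtains J u where "solves_ivp f D x J u" "t \<in> J"
  using assms unfolding existence_ivl_def by blast

text \<open>All solution intervals contain 0, so their union is connected; near each time the flow
  coincides with one particular solution on an open interval and inherits its derivative.\<close>

lemma solves_ivp_flow:
  assumes x: "x \<in> D"
  shows "solves_ivp f D x (existence_ivl f D x) (\<lambda>t. flow f D t x)"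
proof -
  obtain \<delta> where "0 < \<delta>" "\<exists>u. solves_ivp f D x {- \<delta><..<\<delta>} u"
    using uniform_local_existence[of "{x}"] x by auto
  then obtain J0 u0 where u0: "solves_ivp f D x J0 u0" by blast
  then have 0: "0 \<in> J0" "u0 0 = x" unfolding solves_ivp_def by auto
  have "open (existence_ivl f D x)"
    unfolding existence_ivl_def solves_ivp_def by blast
  moreover have "is_interval (existence_ivl f D x)"
    unfolding is_interval_connected_1 existence_ivl_def
    by (rule connected_Union) (auto simp: solves_ivp_def is_interval_connected_1)
  moreover have "flow f D t x \<in> D \<and> ((\<lambda>t. flow f D t x) has_vector_derivative f (flow f D t x)) (at t)"
    if ex: "t \<in> existence_ivl f D x" for t
  proof -
    obtain J u where u: "solves_ivp f D x J u" and t: "t \<in> J" using existence_ivlE[OF ex] .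
    then have J: "open J" "u t \<in> D" "(u has_vector_derivative f (u t)) (at t)"
      unfolding solves_ivp_def by auto
    have "((\<lambda>t. flow f D t x) has_vector_derivative f (u t)) (at t)"
      by (rule has_vector_derivative_transform_within_open[OF J(3,1) t])
        (simp add: solves_ivp_imp_flow(2)[OF u])
    then show ?thesis using solves_ivp_imp_flow(2)[OF u t] J(2) by simp
  qed
  ultimately show ?thesis
    unfolding solves_ivp_def using solves_ivp_imp_flow[OF u0 0(1)] 0(2) by blast
qed

lemma zero_in_existence_ivl [simp]: "x \<in> D \<Longrightarrow> 0 \<in> existence_ivl f D x"
  and flow_zero [simp]: "x \<in> D \<Longrightarrow> flow f D 0 x = x"
  by (simp_all add: solves_ivp_flow[unfolded solves_ivp_def])

lemma flow_in_domain: "x \<in> D \<Longrightarrow> t \<in> existence_ivl f D x \<Longrightarrow> flow f D t x \<in> D"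
  by (simp add: solves_ivp_flow[unfolded solves_ivp_def])

lemma flow_has_vector_derivative:
  assumes "x \<in> D" "t \<in> existence_ivl f D x"
  shows "((\<lambda>t. flow f D t x) has_vector_derivative f (flow f D t x)) (at t)"
  using solves_ivp_flow[OF assms(1)] assms(2) by (simp add: solves_ivp_def)

lemma flow_continuous: "x \<in> D \<Longrightarrow> t \<in> existence_ivl f D x \<Longrightarrow> isCont (\<lambda>t. flow f D t x) t"
  by (rule has_vector_derivative_continuous[OF flow_has_vector_derivative])

lemma solves_ivp_shift:
  assumes "solves_ivp f D x J u" and t: "t \<in> J"
  shows "solves_ivp f D (u t) {s. s + t \<in> J} (\<lambda>s. u (s + t))"
  unfolding solves_ivp_def
proof (intro conjI ballI)
  have J: "open J" "is_interval J"
    "\<And>t. t \<in> J \<Longrightarrow> u t \<in> D \<and> (u has_vector_derivative f (u t)) (at t)"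
    using assms unfolding solves_ivp_def by auto
  show "open {s. s + t \<in> J}"
    using continuous_open_vimage[OF J(1), of "\<lambda>s. s + t"] by (simp add: vimage_def)
  show "is_interval {s. s + t \<in> J}"
    using J(2) unfolding is_interval_1 by (metis add_le_cancel_right mem_Collect_eq)
  show "0 \<in> {s. s + t \<in> J}" "u (0 + t) = u t" using t by auto
  fix s assume "s \<in> {s. s + t \<in> J}"
  then have s: "s + t \<in> J" by simp
  show "u (s + t) \<in> D" using J(3)[OF s] by simp
  have "((\<lambda>s. s + t) has_vector_derivative 1) (at s)"
    by (auto intro!: derivative_eq_intros)
  from vector_diff_chain_at[OF this] J(3)[OF s]
  show "((\<lambda>s. u (s + t)) has_vector_derivative f (u (s + t))) (at s)"
    by (fastforce simp: o_def)
qed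

text \<open>Nothing has to be glued. Shifting the maximal solution from \<open>x\<close> shows that
  the solution from \<open>flow f D t x\<close> runs back to \<open>x\<close> at time
  \<open>- t\<close>; shifting the maximal solution of that point by \<open>- t\<close> then gives a
  solution starting at \<open>x\<close>, to be evaluated at \<open>s + t\<close>.\<close>

lemma flow_add:
  assumes x: "x \<in> D" and t: "t \<in> existence_ivl f D x"
    and s: "s \<in> existence_ivl f D (flow f D t x)"
  shows "s + t \<in> existence_ivl f D x" "flow f D (s + t) x = flow f D s (flow f D t x)"
proof -
  let ?y = "flow f D t x"
  have y: "?y \<in> D" using flow_in_domain x t by blast
  have "solves_ivp f D ?y {s. s + t \<in> existence_ivl f D x} (\<lambda>s. flow f D (s + t) x)"
    using solves_ivp_shift[OF solves_ivp_flow[OF x] t] .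
  from solves_ivp_imp_flow[OF this, of "- t"] x
  have t': "- t \<in> existence_ivl f D ?y" "flow f D (- t) ?y = x" by simp_all
  have "solves_ivp f D x {r. r + - t \<in> existence_ivl f D ?y} (\<lambda>r. flow f D (r + - t) ?y)"
    using solves_ivp_shift[OF solves_ivp_flow[OF y] t'(1)] unfolding t'(2) .
  from solves_ivp_imp_flow[OF this, of "s + t"] s
  show "s + t \<in> existence_ivl f D x" "flow f D (s + t) x = flow f D s ?y" by simp_all
qed

lemma flow_equilibrium:
  assumes "x \<in> D" "f x = 0"
  shows "t \<in> existence_ivl f D x" "flow f D t x = x"
proof -
  have "solves_ivp f D x UNIV (\<lambda>_. x)"
    using assms by (simp add: solves_ivp_def)
  from solves_ivp_imp_flow[OF this, of t]
  show "t \<in> existence_ivl f D x" "flow f D t x = x" by simp_all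
qed

section \<open>Continuous dependence on initial values and compactness of the tube\<close>

lemma flow_lipschitz_near:
  assumes x0: "x0 \<in> D" "\<tau> \<in> existence_ivl f D x0" and \<tau>: "0 \<le> \<tau>"
  obtains \<rho> C where "0 < \<rho>" "\<And>x t. x \<in> D \<Longrightarrow> \<tau> \<in> existence_ivl f D x \<Longrightarrow> norm (x - x0) < \<rho> \<Longrightarrow>
    t \<in> {0..\<tau>} \<Longrightarrow> norm (flow f D t x - flow f D t x0) \<le> C * norm (x - x0)"
proof -
  let ?v = "\<lambda>t. flow f D t x0"
  note v = solves_ivp_flow[OF x0(1)]
  obtain r where r: "0 < r" "compact (\<Union>y\<in>?v ` {0..\<tau>}. cball y r)" "(\<Union>y\<in>?v ` {0..\<tau>}. cball y r) \<subseteq> D"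
    by (rule compact_neighbourhood[OF solves_ivp_compact_image[OF v x0(2) \<tau>]])
  let ?K = "\<Union>y\<in>?v ` {0..\<tau>}. cball y r"
  obtain M where M: "M \<ge> 0" "\<And>y z. y \<in> ?K \<Longrightarrow> z \<in> ?K \<Longrightarrow> norm (f y - f z) \<le> M * norm (y - z)"
    using lipschitz_on_compact[OF r(2,3)] by blast
  \<comment> \<open>While the distance to the reference arc stays at most \<open>r\<close>, the
    exponential estimate holds with the constant \<open>M\<close> of the neighbourhood of that arc.
    Starting closer than \<open>\<rho>\<close> makes this estimate smaller than \<open>r\<close>, so
    the solution never leaves the neighbourhood.\<close>
  define \<rho> where "\<rho> = exp (- (M * \<tau>)) * r"
  have step: "norm (flow f D t x - ?v t) \<le> exp (M * \<tau>) * norm (x - x0)"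
    if x: "x \<in> D" "\<tau> \<in> existence_ivl f D x" and t: "t \<in> {0..\<tau>}"
      and close: "\<And>s. s \<in> {0..t} \<Longrightarrow> norm (flow f D s x - ?v s) \<le> r" for x t
  proof -
    have "norm (flow f D t x - ?v t) \<le> exp (M * t) * norm (flow f D 0 x - ?v 0)"
    proof (rule norm_diff_solutions_le_exp)
      fix s assume s: "s \<in> {0..t}"
      then have s': "s \<in> {0..\<tau>}" using t by simp
      show "((\<lambda>t. flow f D t x) has_vector_derivative f (flow f D s x)) (at s)"
        using flow_has_vector_derivative[OF x(1)] solves_ivp_segment[OF solves_ivp_flow[OF x(1)] x(2) \<tau> s'] by blast
      show "(?v has_vector_derivative f (?v s)) (at s)"
        using flow_has_vector_derivative[OF x0(1)] solves_ivp_segment[OF v x0(2) \<tau> s'] by blast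
      have "?v s \<in> ?K" using s' r(1) by force
      moreover have "flow f D s x \<in> ?K"
        using close[OF s] s' by (auto simp: dist_norm norm_minus_commute intro!: bexI[of _ s])
      ultimately show "norm (f (flow f D s x) - f (?v s)) \<le> M * norm (flow f D s x - ?v s)"
        by (rule M(2)[rotated])
    qed (use t in simp)
    also have "\<dots> \<le> exp (M * \<tau>) * norm (x - x0)"
      using t M(1) x x0 by (simp add: mult_left_mono mult_right_mono)
    finally show ?thesis .
  qed
  show ?thesis
  proof
    show "0 < \<rho>" using r by (simp add: \<rho>_def)
    fix x t assume x: "x \<in> D" "\<tau> \<in> existence_ivl f D x" and \<rho>: "norm (x - x0) < \<rho>" and t: "t \<in> {0..\<tau>}"
    have small: "exp (M * \<tau>) * norm (x - x0) < r"
      using \<rho> by (simp add: \<rho>_def exp_minus field_simps)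
    define w where "w s = norm (flow f D s x - ?v s)" for s
    have w_cont: "continuous_on {0..\<tau>} w"
      unfolding w_def
      by (intro continuous_intros continuous_at_imp_continuous_on ballI flow_continuous x(1) x0(1))
        (use solves_ivp_segment[OF solves_ivp_flow[OF x(1)] x(2) \<tau>] solves_ivp_segment[OF v x0(2) \<tau>] in auto)
    have "w s < r" if s: "s \<in> {0..\<tau>}" for s
    proof (rule ccontr)
      assume "\<not> w s < r"
      \<comment> \<open>At the first exit time \<open>Inf Z\<close>, continuity from the left gives
        distance at most \<open>r\<close> up to and including that time, so \<open>step\<close>
        applies and yields a distance strictly below \<open>r\<close>.\<close>
      define Z where "Z = {s \<in> {0..\<tau>}. r \<le> w s}"
      have "s \<in> Z" using s \<open>\<not> w s < r\<close> by (simp add: Z_def)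
      moreover have "closed Z"
        unfolding Z_def using w_cont by (intro continuous_on_closed_Collect_le) (auto intro: continuous_intros)
      moreover have "bdd_below Z" unfolding Z_def by (intro bdd_belowI[of _ 0]) simp
      ultimately have Inf: "Inf Z \<in> Z" and lower: "\<And>q. q \<in> Z \<Longrightarrow> Inf Z \<le> q"
        using closed_contains_Inf cInf_lower by blast+
      let ?q = "Inf Z"
      have q: "?q \<in> {0..\<tau>}" "r \<le> w ?q" using Inf by (auto simp: Z_def)
      have before: "w s < r" if "s \<in> {0..<?q}" for s
        using lower[of s] that q by (force simp: Z_def)
      have "w 0 < r"
        using small x x0 M \<tau> mult_right_mono[of 1 "exp (M * \<tau>)" "norm (x - x0)"] by (simp add: w_def)
      then have "0 < ?q" using q by (cases "?q = 0") auto
      have "w ?q \<le> r"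
      proof (rule tendsto_upperbound)
        show "(w \<longlongrightarrow> w ?q) (at_left ?q)"
          using w_cont q \<open>0 < ?q\<close> continuous_on_subset[OF w_cont, of "{0..?q}"]
          by (intro continuous_on_Icc_at_leftD[of 0]) auto
        show "\<forall>\<^sub>F s in at_left ?q. w s \<le> r"
          using eventually_at_left_real[OF \<open>0 < ?q\<close>]
          by eventually_elim (use before in \<open>force intro: less_imp_le\<close>)
      qed simp
      then have "w s \<le> r" if "s \<in> {0..?q}" for s
        using before[of s] that by (cases "s = ?q") auto
      then have "w ?q \<le> exp (M * \<tau>) * norm (x - x0)"
        unfolding w_def using step[OF x q(1)] by blast
      then show False using small q by simp
    qed
    then show "norm (flow f D t x - ?v t) \<le> exp (M * \<tau>) * norm (x - x0)"
      using step[OF x t] t unfolding w_def by force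
  qed
qed

text \<open>Existence up to \<open>\<tau>\<close> for every point of \<open>S\<close> makes the tube
  the image of a compact product under the flow, so joint continuity is enough.\<close>

lemma compact_reachable_tube:
  assumes S: "compact S" "S \<subseteq> D" and \<tau>: "0 \<le> \<tau>" "\<And>x. x \<in> S \<Longrightarrow> \<tau> \<in> existence_ivl f D x"
  shows "compact (reachable_tube f D \<tau> S)" "reachable_tube f D \<tau> S \<subseteq> D"
proof -
  have ex: "t \<in> existence_ivl f D x" if "x \<in> S" "t \<in> {0..\<tau>}" for x t
    using solves_ivp_segment[OF solves_ivp_flow \<tau>(2) \<tau>(1)] that S by blast
  then show "reachable_tube f D \<tau> S \<subseteq> D"
    unfolding reachable_tube_def using flow_in_domain S(2) by blast
  have "continuous_on ({0..\<tau>} \<times> S) (\<lambda>(t, x). flow f D t x)"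
    unfolding continuous_on_sequentially
  proof (intro allI ballI impI, elim conjE)
    fix p :: "nat \<Rightarrow> real \<times> (real ^ 'n)" and a
    assume a: "a \<in> {0..\<tau>} \<times> S" and p: "\<forall>n. p n \<in> {0..\<tau>} \<times> S" and lim: "p \<longlonglongrightarrow> a"
    obtain t0 x0 where a_eq: "a = (t0, x0)" and t0: "t0 \<in> {0..\<tau>}" and x0: "x0 \<in> S" using a by auto
    have pS: "snd (p n) \<in> S" "fst (p n) \<in> {0..\<tau>}" for n using p by (auto simp: mem_Times_iff)
    have lims: "(\<lambda>n. fst (p n)) \<longlonglongrightarrow> t0" "(\<lambda>n. snd (p n)) \<longlonglongrightarrow> x0"
      using tendsto_fst[OF lim] tendsto_snd[OF lim] by (simp_all add: a_eq)
    obtain \<rho> C where \<rho>: "0 < \<rho>" and C: "\<And>x t. x \<in> D \<Longrightarrow> \<tau> \<in> existence_ivl f D x \<Longrightarrow> norm (x - x0) < \<rho> \<Longrightarrow>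
      t \<in> {0..\<tau>} \<Longrightarrow> norm (flow f D t x - flow f D t x0) \<le> C * norm (x - x0)"
      using flow_lipschitz_near[of x0 \<tau>] x0 S \<tau> by blast
    \<comment> \<open>The increment is split: Lipschitz dependence on the initial value, uniform in
      time, handles the change of point, and continuity of a single orbit handles the change of
      time.\<close>
    have "(\<lambda>n. flow f D (fst (p n)) (snd (p n)) - flow f D (fst (p n)) x0) \<longlonglongrightarrow> 0"
    proof (rule Lim_null_comparison)
      have "\<forall>\<^sub>F n in sequentially. dist (snd (p n)) x0 < \<rho>" using tendstoD[OF lims(2) \<rho>] .
      then show "\<forall>\<^sub>F n in sequentially. norm (flow f D (fst (p n)) (snd (p n)) - flow f D (fst (p n)) x0)
          \<le> C * norm (snd (p n) - x0)"
      proof eventually_elim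
        case (elim n)
        then show ?case
          using C[OF _ \<tau>(2)[OF pS(1)] _ pS(2)] pS(1) S(2) by (auto simp: dist_norm)
      qed
      show "(\<lambda>n. C * norm (snd (p n) - x0)) \<longlonglongrightarrow> 0"
        using tendsto_mult_right_zero[OF tendsto_norm_zero[OF LIM_zero[OF lims(2)]]] .
    qed
    moreover have "(\<lambda>n. flow f D (fst (p n)) x0) \<longlonglongrightarrow> flow f D t0 x0"
      using flow_continuous[of x0 t0] ex[OF x0 t0] x0 S lims(1) isCont_tendsto_compose by blast
    ultimately have "(\<lambda>n. flow f D (fst (p n)) (snd (p n))) \<longlonglongrightarrow> flow f D t0 x0"
      by (rule Lim_transform[rotated])
    then show "((\<lambda>(t, x). flow f D t x) \<circ> p) \<longlonglongrightarrow> (case a of (t, x) \<Rightarrow> flow f D t x)"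
      by (simp add: a_eq o_def case_prod_beta)
  qed
  moreover have "reachable_tube f D \<tau> S = (\<lambda>(t, x). flow f D t x) ` ({0..\<tau>} \<times> S)"
    unfolding reachable_tube_def using ex by force
  ultimately show "compact (reachable_tube f D \<tau> S)"
    using S(1) by (simp add: compact_continuous_image compact_Times)
qed

end

subsection \<open>Norms and one-sided Lipschitz constants\<close>

lemma is_normD:
  assumes "is_norm N"
  shows "0 \<le> N x" "N x = 0 \<longleftrightarrow> x = 0" "N (c *\<^sub>R x) = \<bar>c\<bar> * N x" "N (x + y) \<le> N x + N y"
  using assms by (simp_all add: is_norm_def)

lemma is_norm_le_euclidean:
  assumes N: "is_norm N"
  obtains C where "0 < C" "\<And>x. N x \<le> C * norm x"
proof -
  have sum: "N (sum g A) \<le> (\<Sum>b\<in>A. N (g b))" if "finite A" for g :: "'b \<Rightarrow> real ^ 'a" and A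
    using that
  proof (induction A rule: finite_induct)
    case empty
    then show ?case using is_normD(2)[OF N, of 0] by simp
  next
    case (insert b A)
    then show ?case using is_normD(4)[OF N, of "g b" "sum g A"] by simp
  qed
  define C where "C = (\<Sum>b\<in>Basis. N b) + 1"
  have "0 \<le> (\<Sum>b\<in>Basis. N b)" by (intro sum_nonneg is_normD(1)[OF N])
  then have "0 < C" by (simp add: C_def)
  moreover have "N x \<le> C * norm x" for x
  proof -
    have "N x = N (\<Sum>b\<in>Basis. (x \<bullet> b) *\<^sub>R b)" by (simp add: euclidean_representation)
    also have "\<dots> \<le> (\<Sum>b\<in>Basis. \<bar>x \<bullet> b\<bar> * N b)"
      using sum[OF finite_Basis, of "\<lambda>b. (x \<bullet> b) *\<^sub>R b"] by (simp add: is_normD(3)[OF N])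
    also have "\<dots> \<le> (\<Sum>b\<in>Basis. norm x * N b)"
      by (intro sum_mono mult_right_mono Basis_le_norm is_normD(1)[OF N])
    also have "\<dots> \<le> C * norm x" by (simp add: C_def algebra_simps sum_distrib_left)
    finally show ?thesis .
  qed
  ultimately show ?thesis using that by blast
qed

lemma is_norm_continuous:
  assumes N: "is_norm N"
  shows "continuous_on UNIV N"
proof -
  obtain C where C: "0 < C" "\<And>x. N x \<le> C * norm x" using is_norm_le_euclidean[OF N] by blast
  have "\<bar>N x - N y\<bar> \<le> C * norm (x - y)" for x y
  proof -
    have "N x \<le> N (x - y) + N y" "N y \<le> N (y - x) + N x"
      using is_normD(4)[OF N, of "x - y" y] is_normD(4)[OF N, of "y - x" x] by auto
    then show ?thesis using C(2)[of "x - y"] C(2)[of "y - x"] by (auto simp: norm_minus_commute)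
  qed
  then show ?thesis
    using C by (intro lipschitz_on_continuous_on[of C] lipschitz_onI) (auto simp: dist_norm)
qed

lemma is_norm_ge_euclidean:
  assumes N: "is_norm N"
  obtains c where "0 < c" "\<And>x. c * norm x \<le> N x"
proof -
  obtain a where a: "a \<in> sphere 0 1" "\<And>x. x \<in> sphere 0 1 \<Longrightarrow> N a \<le> N x"
    using continuous_attains_inf[of "sphere 0 1" N] continuous_on_subset[OF is_norm_continuous[OF N]]
    by auto
  have "N a * norm x \<le> N x" for x
  proof (cases "x = 0")
    case False
    have "N a \<le> N ((1 / norm x) *\<^sub>R x)" using False by (intro a(2)) simp
    also have "\<dots> = N x / norm x" by (simp only: is_normD(3)[OF N]) simp
    finally show ?thesis using False by (simp add: field_simps)
  qed (use is_normD(1)[OF N] in simp)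
  moreover have "0 < N a"
    using is_normD(1)[OF N, of a] is_normD(2)[OF N, of a] a(1) by (cases "a = 0") auto
  ultimately show ?thesis using that by blast
qed

lemma locally_lipschitz_imp_field:
  assumes N: "is_norm N" and D: "open D" and f: "locally_lipschitz N D f"
  shows "locally_lipschitz_field f D"
proof
  show "open D" by fact
  fix K assume "compact K" "K \<subseteq> D"
  then obtain M where "lipschitz_const_over N f K M" using f by (auto simp: locally_lipschitz_def)
  then have M: "0 \<le> M" "\<And>x y. x \<in> K \<Longrightarrow> y \<in> K \<Longrightarrow> N (f y - f x) \<le> M * N (y - x)"
    by (simp_all add: lipschitz_const_over_def)
  obtain c where c: "0 < c" "\<And>x. c * norm x \<le> N x" using is_norm_ge_euclidean[OF N] by blast
  obtain C where C: "0 < C" "\<And>x. N x \<le> C * norm x" using is_norm_le_euclidean[OF N] by blast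
  have "norm (f y - f z) \<le> (M * C / c) * norm (y - z)" if "y \<in> K" "z \<in> K" for y z
  proof -
    have "c * norm (f y - f z) \<le> M * N (y - z)" 
      using c(2)[of "f y - f z"] M(2)[OF that(2,1)] by simp
    also have "\<dots> \<le> M * (C * norm (y - z))" using M(1) C(2) by (simp add: mult_left_mono)
    finally show ?thesis using c(1) by (simp add: field_simps)
  qed
  moreover have "0 \<le> M * C / c" using M c C by simp
  ultimately show "\<exists>M\<ge>0. \<forall>y\<in>K. \<forall>z\<in>K. norm (f y - f z) \<le> M * norm (y - z)" by blast
qed

text \<open>With only an upper Dini derivative, the estimate is propagated by a supremum argument:
  for each rate \<open>k > L\<close>, the last time at which the bound with \<open>k\<close> holds
  must be \<open>r\<close>. Letting \<open>k\<close> decrease to \<open>L\<close> gives the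
  claim.\<close>

lemma upper_right_dini_exp_bound:
  assumes r: "0 \<le> r" and cont: "continuous_on {0..r} g"
    and pos: "\<And>t. t \<in> {0..<r} \<Longrightarrow> 0 < g t"
    and dini: "\<And>t. t \<in> {0..<r} \<Longrightarrow> upper_right_dini g t \<le> ereal (L * g t)"
  shows "g r \<le> exp (L * r) * g 0"
proof -
  have bound: "g r \<le> exp (k * r) * g 0" if k: "L < k" for k
  proof -
    define A where "A = {t \<in> {0..r}. g t \<le> exp (k * t) * g 0}"
    have "closed A"
      unfolding A_def by (intro continuous_on_closed_Collect_le cont continuous_intros closed_real_atLeastAtMost)
    moreover have "0 \<in> A" using r by (simp add: A_def)
    moreover have bdd: "bdd_above A" unfolding A_def by (intro bdd_aboveI[of _ r]) simp
    ultimately have Sup: "Sup A \<in> A" using closed_contains_Sup by blast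
    define T where "T = Sup A"
    have T: "0 \<le> T" "T \<le> r" "g T \<le> exp (k * T) * g 0" using Sup by (auto simp: A_def T_def)
    have "T = r"
    proof (rule ccontr)
      assume "T \<noteq> r"
      then have Tr: "T \<in> {0..<r}" using T by simp
      \<comment> \<open>Positivity of \<open>g T\<close> turns \<open>L < k\<close> into a strict
        bound on the Limsup, so the difference quotients obey it for all small \<open>h > 0\<close>
        and the estimate reaches beyond \<open>T\<close>.\<close>
      have "upper_right_dini g T < ereal (k * g T)"
        using dini[OF Tr] pos[OF Tr] k by (elim order_le_less_trans) simp
      then have "\<forall>\<^sub>F h in at_right 0. ereal ((g (T + h) - g T) / h) < ereal (k * g T)"
        unfolding upper_right_dini_def by (rule Limsup_lessD)
      moreover have "\<forall>\<^sub>F h in at_right 0. h \<in> {0<..<r - T}"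
        using Tr by (intro eventually_at_right_real) simp
      ultimately have "\<forall>\<^sub>F h in at_right 0. (g (T + h) - g T) / h < k * g T \<and> h \<in> {0<..<r - T}"
        by eventually_elim simp
      then obtain h where h: "(g (T + h) - g T) / h < k * g T" "h \<in> {0<..<r - T}"
        using eventually_happens trivial_limit_at_right_real by blast
      then have "g (T + h) \<le> (1 + k * h) * g T" by (simp add: field_simps)
      also have "\<dots> \<le> exp (k * h) * g T"
        using pos[OF Tr] by (intro mult_right_mono exp_ge_add_one_self) simp
      also have "\<dots> \<le> exp (k * h) * (exp (k * T) * g 0)" using T by simp
      also have "\<dots> = exp (k * (T + h)) * g 0" by (simp add: exp_add distrib_left)
      finally have "T + h \<in> A" using h T by (simp add: A_def)
      then have "T + h \<le> T" unfolding T_def using cSup_upper bdd by blast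
      then show False using h by simp
    qed
    then show ?thesis using T by simp
  qed
  show ?thesis
  proof (rule tendsto_lowerbound)
    show "((\<lambda>k. exp (k * r) * g 0) \<longlongrightarrow> exp (L * r) * g 0) (at_right L)"
      by (intro tendsto_intros)
    show "\<forall>\<^sub>F k in at_right L. g r \<le> exp (k * r) * g 0"
      using eventually_at_right_less by eventually_elim (rule bound)
  qed simp
qed

section \<open>The one-sided Lipschitz constant\<close>

lemma associated_weak_pairing_cauchy_schwarz:
  assumes "associated_weak_pairing N wp"
  shows "wp x y \<le> N x * N y"
  using assms unfolding associated_weak_pairing_def weak_pairing_def by (metis abs_le_D1)

text \<open>A \<open>LEAST\<close> over the reals is informative only if a least element exists.
  Here the set of admissible constants contains \<open>M\<close> by Cauchy-Schwarz, is bounded below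
  by the quotient at two distinct points, and contains its infimum. If \<open>K\<close> had at most
  one point, every real number would be admissible, which is why \<open>a\<close> and
  \<open>b\<close> appear.\<close>

lemma
  assumes N: "is_norm N" and wp: "associated_weak_pairing N wp"
    and lip: "lipschitz_const_over N f K M" and K: "a \<in> K" "b \<in> K" "a \<noteq> b"
  shows one_sided_lipschitz_const_le: "one_sided_lipschitz_const N wp f K \<le> M"
    and one_sided_lipschitz_const_bound: "\<forall>x\<in>K. \<forall>y\<in>K.
      wp (f y - f x) (y - x) \<le> one_sided_lipschitz_const N wp f K * (N (y - x))\<^sup>2"
proof -
  define P where "P L \<longleftrightarrow> (\<forall>x\<in>K. \<forall>y\<in>K. wp (f y - f x) (y - x) \<le> L * (N (y - x))\<^sup>2)" for L
  have PM: "P M"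
    unfolding P_def
  proof (intro ballI)
    fix x y assume "x \<in> K" "y \<in> K"
    have "wp (f y - f x) (y - x) \<le> N (f y - f x) * N (y - x)"
      by (rule associated_weak_pairing_cauchy_schwarz[OF wp])
    also have "\<dots> \<le> M * N (y - x) * N (y - x)"
      using lip \<open>x \<in> K\<close> \<open>y \<in> K\<close> is_normD(1)[OF N]
      unfolding lipschitz_const_over_def by (intro mult_right_mono) auto
    finally show "wp (f y - f x) (y - x) \<le> M * (N (y - x))\<^sup>2"
      by (simp add: power2_eq_square mult.assoc)
  qed
  have quotient: "wp (f y - f x) (y - x) / (N (y - x))\<^sup>2 \<le> L"
    if "P L" "x \<in> K" "y \<in> K" "x \<noteq> y" for L x y
  proof -
    have "0 < (N (y - x))\<^sup>2" using that(4) is_normD(2)[OF N, of "y - x"] by simp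
    then show ?thesis using that unfolding P_def by (simp add: divide_le_eq)
  qed
  have bdd: "bdd_below (Collect P)"
    using quotient[of _ a b] K by (intro bdd_belowI) auto
  define I where "I = Inf (Collect P)"
  have PI: "P I"
    unfolding P_def
  proof (intro ballI)
    fix x y assume xy: "x \<in> K" "y \<in> K"
    show "wp (f y - f x) (y - x) \<le> I * (N (y - x))\<^sup>2"
    proof (cases "x = y")
      case True
      then have "N (y - x) = 0" using is_normD(2)[OF N, of "y - x"] by simp
      then show ?thesis using PM xy unfolding P_def by fastforce
    next
      case False
      have "wp (f y - f x) (y - x) / (N (y - x))\<^sup>2 \<le> I"
        unfolding I_def using PM quotient[OF _ xy False] by (intro cInf_greatest) auto
      moreover have "0 < (N (y - x))\<^sup>2" using False is_normD(2)[OF N, of "y - x"] by simp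
      ultimately show ?thesis by (simp add: divide_le_eq)
    qed
  qed
  have "one_sided_lipschitz_const N wp f K = I"
    unfolding one_sided_lipschitz_const_def P_def[symmetric]
    by (rule Least_equality[of P I]) (use PI bdd in \<open>auto simp: I_def intro: cInf_lower\<close>)
  moreover have "I \<le> M" using PM bdd by (auto simp: I_def intro: cInf_lower)
  ultimately show "one_sided_lipschitz_const N wp f K \<le> M"
    "\<forall>x\<in>K. \<forall>y\<in>K.
      wp (f y - f x) (y - x) \<le> one_sided_lipschitz_const N wp f K * (N (y - x))\<^sup>2"
    using PI unfolding P_def by simp_all
qed

lemma exp_eq_h_fun: "exp (L * r) = 1 + L * h_fun r L"
  by (simp add: h_fun_def)

text \<open>\<open>h_fun r L\<close> is the integral of \<open>exp (L * s)\<close> for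
  \<open>s\<close> from 0 to \<open>r\<close>, hence increasing in \<open>r\<close> whatever the
  sign of \<open>L\<close>; the cases only track the direction of the division.\<close>

lemma h_fun_mono: "r \<le> s \<Longrightarrow> h_fun r L \<le> h_fun s L"
  by (cases "L > 0") (auto simp: h_fun_def divide_right_mono intro!: divide_right_mono_neg)

lemma h_fun_nonneg: "0 \<le> r \<Longrightarrow> 0 \<le> h_fun r L"
  using h_fun_mono[of 0 r L] by (simp add: h_fun_def split: if_splits)

subsection \<open>Recurrence and decay along the flow\<close>

context locally_lipschitz_field
begin

text \<open>An orbit reaching \<open>xs\<close> could be followed backwards to its start, but the
  backward flow fixes \<open>xs\<close>. This keeps the distance to the equilibrium positive, so
  that one may divide by it.\<close>

lemma flow_neq_equilibrium:
  assumes "xs \<in> D" "f xs = 0" "y \<in> D" "y \<noteq> xs" "t \<in> existence_ivl f D y"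
  shows "flow f D t y \<noteq> xs"
proof
  assume "flow f D t y = xs"
  then have "flow f D (- t + t) y = xs"
    using flow_add(2)[of y t "- t"] flow_equilibrium[OF assms(1,2), of "- t"] assms by simp
  then show False using assms by simp
qed

lemma flow_equilibrium_distance_bound:
  assumes N: "is_norm N" and wp: "associated_weak_pairing N wp"
    and xs: "xs \<in> D" "f xs = 0" and y: "y \<in> D" and r: "0 \<le> r" "r \<in> existence_ivl f D y"
    and L: "\<And>s. s \<in> {0..r} \<Longrightarrow>
      wp (f (flow f D s y)) (flow f D s y - xs) \<le> L * (N (flow f D s y - xs))\<^sup>2"
  shows "N (flow f D r y - xs) \<le> exp (L * r) * N (y - xs)"
proof (cases "y = xs")
  case True
  then show ?thesis using flow_equilibrium[OF xs] is_normD(2)[OF N, of 0] by simp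
next
  case False
  define u where "u s = flow f D s y - xs" for s
  have ex: "s \<in> existence_ivl f D y" if "s \<in> {0..r}" for s
    using solves_ivp_segment[OF solves_ivp_flow[OF y] r(2,1) that] .
  have u: "(u has_vector_derivative f (flow f D s y)) (at s)" if "s \<in> existence_ivl f D y" for s
    unfolding u_def using flow_has_vector_derivative[OF y that]
    by (auto intro!: derivative_eq_intros)
  note formula = wp[unfolded associated_weak_pairing_def curve_norm_derivative_formula_def,
      THEN conjunct2, THEN conjunct2]
  have pos: "0 < N (u s)" if "s \<in> {0..r}" for s
    using flow_neq_equilibrium[OF xs y False ex[OF that]] is_normD(1,2)[OF N, of "u s"]
    by (simp add: u_def less_le)
  have "N (u r) \<le> exp (L * r) * N (u 0)"
  proof (rule upper_right_dini_exp_bound[OF r(1)])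
    have "continuous_on {0..r} u"
      using u ex by (intro continuous_at_imp_continuous_on ballI) (blast intro: has_vector_derivative_continuous)
    then show "continuous_on {0..r} (\<lambda>s. N (u s))"
      by (rule continuous_on_compose2[OF is_norm_continuous[OF N]]) simp
    fix t assume "t \<in> {0..<r}"
    then have t: "t \<in> {0..r}" by simp
    show "0 < N (u t)" using pos[OF t] .
    \<comment> \<open>The curve formula asks for differentiability on an open interval around
      \<open>t\<close>; openness of the existence interval provides one even at
      \<open>t = 0\<close>.\<close>
    have "open (existence_ivl f D y)" using solves_ivp_flow[OF y] by (simp add: solves_ivp_def)
    then obtain e where e: "0 < e" "ball t e \<subseteq> existence_ivl f D y"
      using ex[OF t] openE by blast
    then have "\<forall>s\<in>{t - e<..<t + e}. (u has_vector_derivative f (flow f D s y)) (at s)"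
      using u by (auto simp: ball_eq_greaterThanLessThan)
    moreover have "t \<in> {t - e<..<t + e}" using e by simp
    ultimately have dini: "ereal (N (u t)) * upper_right_dini (\<lambda>s. N (u s)) t = ereal (wp (f (flow f D t y)) (u t))"
      using formula[THEN spec[of _ u], THEN spec[of _ "\<lambda>s. f (flow f D s y)"],
          THEN spec[of _ "t - e"], THEN spec[of _ "t + e"]] by simp
    have "wp (f (flow f D t y)) (u t) \<le> L * (N (u t))\<^sup>2" using L[OF t] by (simp add: u_def)
    then have "wp (f (flow f D t y)) (u t) \<le> (L * N (u t)) * N (u t)"
      by (simp add: power2_eq_square)
    \<comment> \<open>A product with the positive number \<open>N (u t)\<close> is finite here, so
      the Dini derivative is a real number and the division can be done in the reals.\<close>
    moreover obtain d where d: "upper_right_dini (\<lambda>s. N (u s)) t = ereal d"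
      using dini pos[OF t] by (cases "upper_right_dini (\<lambda>s. N (u s)) t") auto
    ultimately have "d * N (u t) \<le> (L * N (u t)) * N (u t)"
      using dini by (simp add: mult.commute[of d])
    then show "upper_right_dini (\<lambda>s. N (u s)) t \<le> ereal (L * N (u t))"
      unfolding d using pos[OF t] by (simp only: mult_le_cancel_right_pos ereal_less_eq(3))
  qed
  then show ?thesis using y by (simp add: u_def)
qed

text \<open>Choosing the last good time up to \<open>t\<close> replaces an iteration whose steps
  have no positive lower bound. The final conclusion lets \<open>flow_add\<close> reach time
  \<open>t\<close>, so global existence is obtained here as well.\<close>

lemma recurrence_times:
  assumes S: "compact S" "S \<subseteq> D" and V: "continuous_on S V"
    and rec: "\<And>y. y \<in> S \<Longrightarrow> \<exists>s\<in>containment_times f D S y \<tau>. exp (\<alpha> * s) * V (flow f D s y) \<le> V y"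
    and x: "x \<in> S" and t: "0 \<le> t"
  obtains m where "0 \<le> m" "m \<le> t" "t - m \<le> \<tau>" "m \<in> existence_ivl f D x" "flow f D m x \<in> S"
    "exp (\<alpha> * m) * V (flow f D m x) \<le> V x" "t - m \<in> existence_ivl f D (flow f D m x)"
proof -
  define P where "P m \<longleftrightarrow> 0 \<le> m \<and> m \<in> existence_ivl f D x \<and> flow f D m x \<in> S \<and>
    exp (\<alpha> * m) * V (flow f D m x) \<le> V x" for m
  have xD: "x \<in> D" using x S by blast
  have step: "\<exists>s. 0 < s \<and> s \<le> \<tau> \<and> s \<in> existence_ivl f D (flow f D m x) \<and> P (s + m)" if "P m" for m
  proof -
    have m: "0 \<le> m" "m \<in> existence_ivl f D x" "flow f D m x \<in> S" "exp (\<alpha> * m) * V (flow f D m x) \<le> V x"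
      using that by (auto simp: P_def)
    obtain s where s: "0 < s" "s \<le> \<tau>" "s \<in> existence_ivl f D (flow f D m x)"
      "flow f D s (flow f D m x) \<in> S" "exp (\<alpha> * s) * V (flow f D s (flow f D m x)) \<le> V (flow f D m x)"
      using rec[OF m(3)] by (auto simp: containment_times_def)
    note add = flow_add[OF xD m(2) s(3)]
    have "exp (\<alpha> * (s + m)) * V (flow f D (s + m) x)
        = exp (\<alpha> * m) * (exp (\<alpha> * s) * V (flow f D s (flow f D m x)))"
      by (simp add: add exp_add distrib_left)
    also have "\<dots> \<le> exp (\<alpha> * m) * V (flow f D m x)" using s by simp
    finally have "P (s + m)" using add s m by (simp add: P_def)
    then show ?thesis using s by blast
  qed
  define A where "A = {m. P m \<and> m \<le> t}"
  define T where "T = Sup A"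
  have A0: "0 \<in> A" using x xD t by (simp add: A_def P_def)
  have bdd: "bdd_above A" unfolding A_def by (intro bdd_aboveI[of _ t]) simp
  have T: "0 \<le> T" "T \<le> t"
    unfolding T_def using A0 bdd by (auto intro: cSup_upper cSup_least simp: A_def)
  obtain \<delta> where \<delta>: "0 < \<delta>" "\<And>x. x \<in> S \<Longrightarrow> \<exists>u. solves_ivp f D x {- \<delta><..<\<delta>} u"
    using uniform_local_existence[OF S] by blast
  \<comment> \<open>Before a limit can be taken at \<open>T\<close>, the solution must exist there:
    a good time closer than \<open>\<delta>\<close> to \<open>T\<close> restarts it in
    \<open>S\<close>, and the uniform existence time carries it to \<open>T\<close>.\<close>
  have "\<exists>m\<in>A. T - \<delta> < m"
    using less_cSup_iff[of A "T - \<delta>"] A0 bdd \<delta>(1) by (auto simp: T_def)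
  then obtain m where m: "m \<in> A" "T - \<delta> < m" by blast
  then have mP: "m \<in> existence_ivl f D x" "flow f D m x \<in> S" by (auto simp: A_def P_def)
  have "m \<le> T" unfolding T_def using m bdd by (auto intro: cSup_upper)
  then have "T - m \<in> {- \<delta><..<\<delta>}" using m \<delta> by simp
  then have "T - m \<in> existence_ivl f D (flow f D m x)"
    using \<delta>(2)[OF mP(2)] solves_ivp_imp_flow(1) by blast
  then have TI: "T \<in> existence_ivl f D x"
    using flow_add(1)[OF xD mP(1)] by fastforce
  have "T \<in> closure A" unfolding T_def using A0 bdd by (intro closure_contains_Sup) auto
  then obtain a where a: "\<And>n. a n \<in> A" "a \<longlonglongrightarrow> T" unfolding closure_sequential by blast
  have aP: "flow f D (a n) x \<in> S" "exp (\<alpha> * a n) * V (flow f D (a n) x) \<le> V x" for n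
    using a(1)[of n] by (auto simp: A_def P_def)
  have lim: "(\<lambda>n. flow f D (a n) x) \<longlonglongrightarrow> flow f D T x"
    using isCont_tendsto_compose[OF flow_continuous[OF xD TI] a(2)] .
  have TS: "flow f D T x \<in> S"
    using closed_sequentially[OF compact_imp_closed[OF S(1)] aP(1) lim] .
  have "(\<lambda>n. V (flow f D (a n) x)) \<longlonglongrightarrow> V (flow f D T x)"
    using continuous_on_tendsto_compose[OF V lim TS] aP(1) by simp
  then have "(\<lambda>n. exp (\<alpha> * a n) * V (flow f D (a n) x)) \<longlonglongrightarrow> exp (\<alpha> * T) * V (flow f D T x)"
    by (intro tendsto_intros a(2))
  then have TV: "exp (\<alpha> * T) * V (flow f D T x) \<le> V x"
    using aP(2) by (intro LIMSEQ_le_const2) auto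
  have "P T" using T TI TS TV by (simp add: P_def)
  \<comment> \<open>Since \<open>T\<close> is the largest good time not exceeding \<open>t\<close>,
    the next good time lies beyond \<open>t\<close>; this gives both
    \<open>t - T < s \<le> \<tau>\<close> and existence up to \<open>t\<close>.\<close>
  then obtain s where s: "0 < s" "s \<le> \<tau>" "s \<in> existence_ivl f D (flow f D T x)" "P (s + T)"
    using step by blast
  have "s + T \<notin> A" using cSup_upper[OF _ bdd, of "s + T"] s(1) by (auto simp: T_def)
  then have "t - T < s" using s(4) by (auto simp: A_def)
  then have "t - T \<in> {0..s}" using T by simp
  moreover have "flow f D T x \<in> D" using TS S by blast
  ultimately have "t - T \<in> existence_ivl f D (flow f D T x)"
    using solves_ivp_segment[OF solves_ivp_flow s(3)] s(1) by simp
  then show ?thesis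
    using that[of T] T TI TS TV \<open>t - T < s\<close> s(2) by simp
qed

end

section \<open>Exponential decay on \<open>S\<close>\<close>

theorem theorem3:
  fixes N :: "real ^ 'n \<Rightarrow> real"
    and wp :: "real ^ 'n \<Rightarrow> real ^ 'n \<Rightarrow> real"
    and f :: "real ^ 'n \<Rightarrow> real ^ 'n"
    and D S :: "(real ^ 'n) set"
    and xs :: "real ^ 'n"
    and V :: "real ^ 'n \<Rightarrow> real"
    and a1 a2 \<alpha> \<tau> :: real
  assumes "is_norm N"
    and "associated_weak_pairing N wp"
    and "open D"
    and "locally_lipschitz N D f"
    and "xs \<in> D" and "f xs = 0"
    and "compact S" and "S \<subseteq> D" and "xs \<in> interior S"
    and "ERLF N f D xs S V a1 a2 \<alpha> \<tau>"
  shows "let K = closure (reachable_tube f D \<tau> S);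
             L = one_sided_lipschitz_const N wp f K
         in compact K \<and> K \<subseteq> D \<and>
            (\<forall>Lbar. lipschitz_const_over N f K Lbar \<longrightarrow>
               (let C = a2 / a1 * exp (\<alpha> * \<tau>) * (1 + Lbar * h_fun \<tau> L)
                in \<forall>x\<in>S. \<forall>t\<ge>0. t \<in> existence_ivl f D x \<and>
                     N (flow f D t x - xs) \<le> C * exp (- \<alpha> * t) * N (x - xs)))"
proof -
  note N = \<open>is_norm N\<close> and wp = \<open>associated_weak_pairing N wp\<close>
  note S = \<open>compact S\<close> \<open>S \<subseteq> D\<close> and xs = \<open>xs \<in> D\<close> \<open>f xs = 0\<close>
  interpret locally_lipschitz_field f D
    using assms by (intro locally_lipschitz_imp_field)
  have V: "continuous_on S V" and V0: "\<And>x. x \<in> D \<Longrightarrow> 0 \<le> V x"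
    and pos: "0 < a1" "0 < a2" "0 < \<alpha>" "0 < \<tau>"
    and Va: "\<And>x. x \<in> D \<Longrightarrow> a1 * N (x - xs) \<le> V x" "\<And>x. x \<in> D \<Longrightarrow> V x \<le> a2 * N (x - xs)"
    and rec': "\<And>x. x \<in> S - {xs} \<Longrightarrow> \<exists>s\<in>containment_times f D S x \<tau>. exp (\<alpha> * s) * V (flow f D s x) \<le> V x"
    using \<open>ERLF N f D xs S V a1 a2 \<alpha> \<tau>\<close> S(2) continuous_on_subset unfolding ERLF_def by blast+
  have xsS: "xs \<in> S" using \<open>xs \<in> interior S\<close> interior_subset by blast
  \<comment> \<open>The recurrence condition excludes \<open>xs\<close>; there \<open>V\<close>
    vanishes and the orbit is constant, so the containment time \<open>\<tau>\<close> is a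
    witness.\<close>
  have "V xs = 0" using V0[OF xs(1)] Va(2)[OF xs(1)] is_normD(2)[OF N, of 0] by simp
  then have "\<exists>s\<in>containment_times f D S xs \<tau>. exp (\<alpha> * s) * V (flow f D s xs) \<le> V xs"
    using flow_equilibrium[OF xs, of \<tau>] xsS pos
    by (intro bexI[of _ \<tau>]) (auto simp: containment_times_def)
  then have rec: "\<exists>s\<in>containment_times f D S x \<tau>. exp (\<alpha> * s) * V (flow f D s x) \<le> V x" if "x \<in> S" for x
    using rec' that by (cases "x = xs") auto
  have ex: "t \<in> existence_ivl f D x" if x: "x \<in> S" and t: "0 \<le> t" for x t
  proof -
    obtain m where m: "m \<in> existence_ivl f D x" "t - m \<in> existence_ivl f D (flow f D m x)"
      using recurrence_times[OF S V rec x t] by blast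
    then show ?thesis using flow_add(1)[of x m "t - m"] x S by auto
  qed
  define R where "R = reachable_tube f D \<tau> S"
  have R: "compact R" "R \<subseteq> D" "closure R = R"
    using compact_reachable_tube[OF S, of \<tau>] ex pos
    by (auto simp: R_def compact_imp_closed closure_closed)
  have flow_R: "flow f D s y \<in> R" if "y \<in> S" "s \<in> {0..\<tau>}" for y s
    using that ex unfolding R_def reachable_tube_def by fastforce
  have SR: "S \<subseteq> R" using flow_R[of _ 0] S pos by fastforce
  \<comment> \<open>A second point of \<open>S\<close>, available because \<open>xs\<close> is
    interior, is required for the least one-sided constant over \<open>R\<close> to exist.\<close>
  obtain b where b: "b \<in> S" "b \<noteq> xs"
  proof -
    obtain e where e: "0 < e" "cball xs e \<subseteq> S" using \<open>xs \<in> interior S\<close> mem_interior_cball by blast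
    obtain v :: "real ^ 'n" where v: "norm v = e" using e(1) vector_choose_size[of e] by auto
    show ?thesis using that[of "xs + v"] e v by (auto simp: dist_norm subset_iff)
  qed
  define L where "L = one_sided_lipschitz_const N wp f R"
  have "N (flow f D t x - xs) \<le> a2 / a1 * exp (\<alpha> * \<tau>) * (1 + Lbar * h_fun \<tau> L) * exp (- \<alpha> * t) * N (x - xs)"
    if lip: "lipschitz_const_over N f R Lbar" and x: "x \<in> S" and t: "0 \<le> t" for Lbar x t
  proof -
    have xs_b: "xs \<in> R" "b \<in> R" "xs \<noteq> b" using b xsS SR by auto
    \<comment> \<open>With \<open>xs\<close> as the first point of the one-sided bound,
      \<open>f xs = 0\<close> drops out and an estimate for the distance to the equilibrium
      remains.\<close>
    have L: "L \<le> Lbar" "\<And>y. y \<in> R \<Longrightarrow> wp (f y) (y - xs) \<le> L * (N (y - xs))\<^sup>2"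
      using one_sided_lipschitz_const_le[OF N wp lip xs_b]
        bspec[OF one_sided_lipschitz_const_bound[OF N wp lip xs_b] xs_b(1)] xs(2)
      by (auto simp: L_def)
    have Lbar: "0 \<le> Lbar" using lip by (simp add: lipschitz_const_over_def)
    obtain m where m: "0 \<le> m" "m \<le> t" "t - m \<le> \<tau>" "m \<in> existence_ivl f D x" "flow f D m x \<in> S"
      "exp (\<alpha> * m) * V (flow f D m x) \<le> V x" "t - m \<in> existence_ivl f D (flow f D m x)"
      using recurrence_times[OF S V rec x t] by blast
    let ?y = "flow f D m x" and ?r = "t - m"
    let ?B = "1 + Lbar * h_fun \<tau> L"
    have D: "x \<in> D" "?y \<in> D" using x m(5) S by auto
    \<comment> \<open>First \<open>L\<close> is replaced by \<open>Lbar\<close>, using that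
      \<open>h_fun\<close> is nonnegative, then \<open>t - m\<close> by \<open>\<tau>\<close>, using
      \<open>0 \<le> Lbar\<close> and monotonicity.\<close>
    have "exp (L * ?r) \<le> 1 + Lbar * h_fun ?r L"
      using L(1) h_fun_nonneg[of ?r L] m by (simp add: exp_eq_h_fun mult_right_mono)
    also have "\<dots> \<le> ?B" using Lbar h_fun_mono[OF m(3)] by (simp add: mult_left_mono)
    finally have B: "exp (L * ?r) \<le> ?B" .
    then have B0: "0 \<le> ?B" using exp_ge_zero order_trans by blast
    have "N (flow f D t x - xs) = N (flow f D ?r ?y - xs)"
      using flow_add(2)[OF D(1) m(4,7)] by simp
    also have "\<dots> \<le> exp (L * ?r) * N (?y - xs)"
      by (rule flow_equilibrium_distance_bound[OF N wp xs D(2) _ m(7)])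
        (use m L(2) flow_R in auto)
    also have "\<dots> \<le> ?B * N (?y - xs)" using B is_normD(1)[OF N] by (rule mult_right_mono)
    also have "?B * N (?y - xs) \<le> ?B * (exp (\<alpha> * \<tau>) * exp (- \<alpha> * t) * (a2 / a1) * N (x - xs))"
    proof (rule mult_left_mono[OF _ B0])
      have "exp (\<alpha> * m) * (a1 * N (?y - xs)) \<le> exp (\<alpha> * m) * V ?y"
        using Va(1)[OF D(2)] by simp
      also have "\<dots> \<le> a2 * N (x - xs)" using m(6) Va(2)[OF D(1)] by simp
      finally have "N (?y - xs) \<le> exp (- (\<alpha> * m)) * (a2 / a1) * N (x - xs)"
        using pos by (simp add: exp_minus field_simps)
      \<comment> \<open>Since \<open>t - \<tau> \<le> m\<close>, decay measured at \<open>m\<close>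
        instead of \<open>t\<close> costs at most the factor \<open>exp (\<alpha> * \<tau>)\<close>,
        which is its origin in the constant \<open>C\<close>.\<close>
      also have "\<dots> \<le> exp (\<alpha> * \<tau> - \<alpha> * t) * (a2 / a1) * N (x - xs)"
      proof (intro mult_right_mono)
        have "\<alpha> * (t - m) \<le> \<alpha> * \<tau>" using m(3) pos by simp
        then show "exp (- (\<alpha> * m)) \<le> exp (\<alpha> * \<tau> - \<alpha> * t)" by (simp add: algebra_simps)
      qed (use pos is_normD(1)[OF N] in auto)
      finally show "N (?y - xs) \<le> exp (\<alpha> * \<tau>) * exp (- \<alpha> * t) * (a2 / a1) * N (x - xs)"
        by (simp add: exp_add[symmetric])
    qed
    finally show ?thesis by (simp add: algebra_simps)
  qed
  then show ?thesis
    using R ex unfolding Let_def R_def[symmetric] L_def by simp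
qed

end
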